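(* For every integer $r\ge 3$, $\mathrm{cov}(r,2r-1)=r$.
   Context: A complete $r$-uniform $r$-partite hypergraph $K$ has a vertex set $V=V(K)$ partitioned into nonempty classes $V_1\cup\dots\cup V_r$, and its edges are exactly the sets containing one vertex from each class. A $k$-coloring of a hypergraph is an assignment of a color from $[k]=\{1,\dots,k\}$ to each edge (not all $k$ colors need be used). A coloring is spanning if every vertex is incident to edges of every color used in the coloring. For an edge-colored hypergraph $H$, let $H_i$ be the subhypergraph on vertex set $V(H)$ consisting of the edges of color $i$. A hypergraph is connected if it has only one vertex or any two distinct vertices can be connected by a sequence of edges each intersecting the next; every hypergraph is uniquely partitioned into connected components. A monochromatic component of $H$ is (the vertex set of) a connected component of $H_i$ for some color $i$. Let $c(H)$ be the minimum integer $m$ such that $V(H)$ can be covered by $m$ monochromatic components of $H$. $\mathrm{cov}(r,k)$ is the maximum of $c(K)$ when $K$ ranges over all spanning $k$-colorings of complete $r$-uniform $r$-partite hypergraphs. *)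

theory Defs
  imports Main "HOL-Library.FuncSet" "HOL-Library.Disjoint_Sets"
begin

(* A hypergraph is given by its vertex set V and its edge set E. *)

definition edge_sequence :: "'a set set \<Rightarrow> 'a \<Rightarrow> 'a \<Rightarrow> 'a set list \<Rightarrow> bool" where
  "edge_sequence E x y es \<longleftrightarrow>
     es \<noteq> [] \<and> set es \<subseteq> E \<and> x \<in> hd es \<and> y \<in> last es \<and>
     (\<forall>j. Suc j < length es \<longrightarrow> es ! j \<inter> es ! Suc j \<noteq> {})"

definition linked :: "'a set \<Rightarrow> 'a set set \<Rightarrow> ('a \<times> 'a) set" where
  "linked V E = {(x, y). x \<in> V \<and> y \<in> V \<and> (x = y \<or> (\<exists>es. edge_sequence E x y es))}"

(* Vertex sets of the connected components; a vertex in no edge forms a component of its own. *)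
definition components :: "'a set \<Rightarrow> 'a set set \<Rightarrow> 'a set set" where
  "components V E = V // linked V E"

(* The vertex classes are P 1, ..., P r; values of P outside {1..r} are irrelevant.
   Hypergraphs are finite. *)
definition partite_classes :: "nat \<Rightarrow> (nat \<Rightarrow> 'a set) \<Rightarrow> bool" where
  "partite_classes r P \<longleftrightarrow>
     (\<forall>i\<in>{1..r}. finite (P i) \<and> P i \<noteq> {}) \<and> disjoint_family_on P {1..r}"

definition verts :: "nat \<Rightarrow> (nat \<Rightarrow> 'a set) \<Rightarrow> 'a set" where
  "verts r P = (\<Union>i\<in>{1..r}. P i)"

definition complete_edges :: "nat \<Rightarrow> (nat \<Rightarrow> 'a set) \<Rightarrow> 'a set set" where
  "complete_edges r P = {e. e \<subseteq> verts r P \<and> (\<forall>i\<in>{1..r}. card (e \<inter> P i) = 1)}"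

definition edge_coloring :: "nat \<Rightarrow> 'a set set \<Rightarrow> ('a set \<Rightarrow> nat) \<Rightarrow> bool" where
  "edge_coloring k E \<chi> \<longleftrightarrow> \<chi> \<in> E \<rightarrow> {1..k}"

definition spanning :: "'a set \<Rightarrow> 'a set set \<Rightarrow> ('a set \<Rightarrow> nat) \<Rightarrow> bool" where
  "spanning V E \<chi> \<longleftrightarrow> (\<forall>v\<in>V. \<forall>i\<in>\<chi> ` E. \<exists>e\<in>E. v \<in> e \<and> \<chi> e = i)"

definition mono_components ::
  "nat \<Rightarrow> 'a set \<Rightarrow> 'a set set \<Rightarrow> ('a set \<Rightarrow> nat) \<Rightarrow> 'a set set" where
  "mono_components k V E \<chi> = (\<Union>i\<in>{1..k}. components V {e \<in> E. \<chi> e = i})"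

definition cover_number ::
  "nat \<Rightarrow> 'a set \<Rightarrow> 'a set set \<Rightarrow> ('a set \<Rightarrow> nat) \<Rightarrow> nat" where
  "cover_number k V E \<chi> =
     (LEAST m. \<exists>S. S \<subseteq> mono_components k V E \<chi> \<and> finite S \<and> card S = m \<and> V \<subseteq> \<Union>S)"

(* Every finite hypergraph is isomorphic to one whose vertices are natural numbers. *)
definition cover_numbers :: "nat \<Rightarrow> nat \<Rightarrow> nat set" where
  "cover_numbers r k =
     {cover_number k (verts r P) (complete_edges r P) \<chi> | (P :: nat \<Rightarrow> nat set) \<chi>.
        partite_classes r P \<and> edge_coloring k (complete_edges r P) \<chi> \<and>
        spanning (verts r P) (complete_edges r P) \<chi>}"

(* Max is meaningful for r \<ge> 2 and k \<ge> 1: see cover_numbers_finite and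
   cover_numbers_nonempty below. *)
definition cov :: "nat \<Rightarrow> nat \<Rightarrow> nat" where
  "cov r k = Max (cover_numbers r k)"

lemma edge_sequence_single: "e \<in> E \<Longrightarrow> x \<in> e \<Longrightarrow> y \<in> e \<Longrightarrow> edge_sequence E x y [e]"
  by (simp add: edge_sequence_def)

lemma edge_sequence_rev:
  assumes "edge_sequence E x y es" shows "edge_sequence E y x (rev es)"
proof -
  have "rev es ! j \<inter> rev es ! Suc j \<noteq> {}" if "Suc j < length es" for j
  proof -
    have *: "Suc (length es - Suc (Suc j)) = length es - Suc j" using that by simp
    have "es ! (length es - Suc (Suc j)) \<inter> es ! Suc (length es - Suc (Suc j)) \<noteq> {}"
      using assms that unfolding edge_sequence_def by simp
    then show ?thesis using that by (simp only: *) (simp add: rev_nth Int_commute)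
  qed
  then show ?thesis using assms by (auto simp: edge_sequence_def hd_rev last_rev)
qed

lemma edge_sequence_append:
  assumes 1: "edge_sequence E x y es" and 2: "edge_sequence E y z fs"
  shows "edge_sequence E x z (es @ fs)"
proof -
  have ne: "es \<noteq> []" "fs \<noteq> []" using 1 2 by (auto simp: edge_sequence_def)
  have "(es @ fs) ! j \<inter> (es @ fs) ! Suc j \<noteq> {}" if j: "Suc j < length (es @ fs)" for j
  proof (cases "Suc j" "length es" rule: linorder_cases)
    case less
    then show ?thesis using 1 by (simp add: edge_sequence_def nth_append)
  next
    case equal
    then have "y \<in> (es @ fs) ! j"
      using 1 ne by (auto simp: edge_sequence_def nth_append last_conv_nth simp flip: equal)
    moreover have "y \<in> (es @ fs) ! Suc j"
      using 2 ne equal by (auto simp: edge_sequence_def nth_append hd_conv_nth)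
    ultimately show ?thesis by blast
  next
    case greater
    then have "Suc j - length es = Suc (j - length es)" by simp
    moreover have "Suc (j - length es) < length fs" using j greater by simp
    ultimately show ?thesis using 2 greater by (simp add: edge_sequence_def nth_append)
  qed
  then show ?thesis using 1 2 by (auto simp: edge_sequence_def)
qed

lemma equiv_linked: "equiv V (linked V E)"
proof (rule equivI)
  show "linked V E \<subseteq> V \<times> V" "refl_on V (linked V E)"
    by (auto simp: linked_def refl_on_def)
  show "sym (linked V E)"
    by (auto simp: sym_def linked_def dest: edge_sequence_rev)
  show "trans (linked V E)"
    by (rule transI) (auto simp: linked_def dest: edge_sequence_append)
qed

lemma complete_edge_through:
  assumes P: "partite_classes r P" and i: "i \<in> {1..r}" "j \<in> {1..r}" "i \<noteq> j"
    and x: "x \<in> P i" and y: "y \<in> P j"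
  shows "\<exists>e\<in>complete_edges r P. x \<in> e \<and> y \<in> e"
proof -
  define f where "f l = (if l = i then x else if l = j then y else SOME z. z \<in> P l)" for l
  have f: "f l \<in> P l" if "l \<in> {1..r}" for l
    using that P x y by (auto simp: f_def partite_classes_def some_in_eq)
  define e where "e = f ` {1..r}"
  have "e \<inter> P l = {f l}" if l: "l \<in> {1..r}" for l
  proof -
    have "f m \<notin> P l" if "m \<in> {1..r}" "m \<noteq> l" for m
      using f[OF that(1)] P l that
      unfolding partite_classes_def disjoint_family_on_def by blast
    then show ?thesis using f[OF l] l unfolding e_def by blast
  qed
  then have "e \<in> complete_edges r P"
    using f by (auto simp: complete_edges_def verts_def e_def)
  moreover have "f i = x" "f j = y" using i by (auto simp: f_def)
  then have "x \<in> e" "y \<in> e" using i by (auto simp: e_def)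
  ultimately show ?thesis by blast
qed

lemma cover_number_le:
  fixes P :: "nat \<Rightarrow> 'a set"
  assumes r: "r \<ge> 2" and P: "partite_classes r P"
    and \<chi>: "edge_coloring k (complete_edges r P) \<chi>"
  shows "cover_number k (verts r P) (complete_edges r P) \<chi> \<le> 2 * k"
proof -
  let ?V = "verts r P" and ?E = "complete_edges r P"
  obtain v w where v: "v \<in> P 1" and w: "w \<in> P 2"
    using P r by (force simp: partite_classes_def)
  define C where "C i x = linked ?V {e \<in> ?E. \<chi> e = i} `` {x}" for i x
  define S where "S = (\<lambda>(i, x). C i x) ` ({1..k} \<times> {v, w})"
  have vV: "v \<in> ?V" "w \<in> ?V" using v w r by (auto simp: verts_def)
  have "S \<subseteq> mono_components k ?V ?E \<chi>"
    using vV by (auto simp: S_def C_def mono_components_def components_def intro: quotientI)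
  moreover have fin: "finite S" by (simp add: S_def)
  moreover have "?V \<subseteq> \<Union>S"
  proof
    fix u assume u: "u \<in> ?V"
    then obtain i where i: "i \<in> {1..r}" "u \<in> P i" by (auto simp: verts_def)
    have "\<exists>e\<in>?E. \<exists>x\<in>{v, w}. x \<in> e \<and> u \<in> e"
    proof (cases "i = 1")
      case True
      then show ?thesis using complete_edge_through[OF P, of 2 i w u] w i r by auto
    next
      case False
      then show ?thesis using complete_edge_through[OF P, of 1 i v u] v i r by auto
    qed
    then obtain e x where e: "e \<in> ?E" "x \<in> {v, w}" "x \<in> e" "u \<in> e" by blast
    then have "\<chi> e \<in> {1..k}" using \<chi> by (auto simp: edge_coloring_def)
    moreover have "u \<in> C (\<chi> e) x"
      using e u vV edge_sequence_single[of e "{e' \<in> ?E. \<chi> e' = \<chi> e}" x u]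
      by (auto simp: C_def linked_def)
    ultimately show "u \<in> \<Union>S" using e by (force simp: S_def)
  qed
  ultimately have "cover_number k ?V ?E \<chi> \<le> card S"
    unfolding cover_number_def by (intro Least_le) blast
  also have "card S \<le> card ({1..k} \<times> {v, w})"
    unfolding S_def by (rule card_image_le) simp
  also have "\<dots> \<le> 2 * k" by (simp add: card_cartesian_product card_insert_if)
  finally show ?thesis .
qed

lemma cover_numbers_finite: "r \<ge> 2 \<Longrightarrow> finite (cover_numbers r k)"
  by (rule finite_subset[of _ "{..2 * k}"]) (auto simp: cover_numbers_def dest: cover_number_le)

lemma cover_numbers_nonempty:
  assumes "r \<ge> 2" "k \<ge> 1" shows "cover_numbers r k \<noteq> {}"
proof -
  let ?P = "\<lambda>i::nat. {i}"
  have P: "partite_classes r ?P"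
    by (auto simp: partite_classes_def disjoint_family_on_def)
  have "{1..r} \<inter> {i} = {i}" if "i \<in> {1..r}" for i using that by auto
  then have "{1..r} \<in> complete_edges r ?P" by (auto simp: complete_edges_def verts_def)
  then have "spanning (verts r ?P) (complete_edges r ?P) (\<lambda>_. 1)"
    unfolding spanning_def verts_def by blast
  moreover have "edge_coloring k (complete_edges r ?P) (\<lambda>_. 1)"
    using assms by (auto simp: edge_coloring_def)
  ultimately show ?thesis using P unfolding cover_numbers_def by blast
qed

end

theory Submission
  imports Defs "HOL-Library.Countable"
begin

text \<open>Upper bound. Suppose that no \<open>r\<close> components cover. Then every color has more than \<open>r\<close>
  components, so each further vertex of an edge can be chosen to destroy a common color of
  the previous ones; hence two vertices of different classes agree in at least \<open>r - 1\<close> colors and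
  three in at least \<open>r - 2\<close>. Covering by \<open>r\<close> common components of two vertices fails only if there are
  \<open>v\<close>, \<open>u\<close> agreeing in a set \<open>A\<close> of exactly \<open>r - 1\<close> colors. Any vertex of a third class leaves the
  component of \<open>v\<close> in at most one color of \<open>A\<close>. The vertices of the class of \<open>v\<close> that leave it in all
  colors of \<open>A\<close> lie in a single component of \<open>u\<close>, and symmetrically, so both classes must contain
  such vertices \<open>x\<close> and \<open>y\<close>. A vertex of a third class then agrees with \<open>u\<close> in at least \<open>r - 2\<close>
  of the \<open>r\<close> colors outside \<open>A\<close>, and with \<open>v\<close> in at least \<open>r - 2\<close> others; this forces \<open>r = 3\<close>, where
  explicit triples of components are seen to cover.

  Lower bound. Let the vertices be vectors with \<open>2r - 1\<close> coordinates, having \<open>r - 1\<close> nonzero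
  entries in the first class and one nonzero entry in the other classes, and color an edge by a
  coordinate in which all its vertices agree. A component then fixes one coordinate, and \<open>r - 1\<close>
  such conditions are avoided by some vector of the first class.\<close>

subsection \<open>Colorings that cannot be covered by \<open>r\<close> components\<close>

text \<open>\<open>c i v\<close> stands for the component of \<open>v\<close> in color \<open>i\<close>. The assumptions are contradictory.\<close>

locale uncoverable =
  fixes r :: nat and P :: "nat \<Rightarrow> 'a set" and I :: "'c set" and c :: "'c \<Rightarrow> 'a \<Rightarrow> 'b"
  assumes r3: "3 \<le> r"
    and card_I: "card I = 2 * r - 1"
    and meets: "\<lbrakk>i \<in> I; v \<in> verts r P; j \<in> {1..r}\<rbrakk> \<Longrightarrow> \<exists>w\<in>P j. c i w = c i v"
    and agree: "(\<And>j. j \<in> {1..r} \<Longrightarrow> f j \<in> P j) \<Longrightarrow>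
      \<exists>i\<in>I. \<forall>j\<in>{1..r}. \<forall>l\<in>{1..r}. c i (f j) = c i (f l)"
    and uncovered: "\<lbrakk>T \<subseteq> I \<times> verts r P; card T \<le> r\<rbrakk> \<Longrightarrow>
      \<exists>z\<in>verts r P. \<forall>(i, w)\<in>T. c i z \<noteq> c i w"
begin

section \<open>Avoiding prescribed components, and common colors of vertices of different
  classes\<close>

lemma finite_I: "finite I"
  using card_I r3 by (intro card_ge_0_finite) simp

lemma vertsI: "j \<in> {1..r} \<Longrightarrow> x \<in> P j \<Longrightarrow> x \<in> verts r P"
  by (auto simp: verts_def)

text \<open>Some vertex lies outside the components of all \<open>x\<close> in \<open>X\<close> in
  color \<open>i\<close>. It need not be in class \<open>j\<close>, but by \<open>meets\<close> its
  own component has a vertex there.\<close>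

lemma avoid:
  assumes i: "i \<in> I" and j: "j \<in> {1..r}" and X: "X \<subseteq> verts r P" "finite X" "card X \<le> r"
  shows "\<exists>w\<in>P j. \<forall>x\<in>X. c i w \<noteq> c i x"
proof -
  have "card (Pair i ` X) \<le> r"
    using X card_image_le[of X "Pair i"] by linarith
  then obtain z where z: "z \<in> verts r P" "\<forall>(i, w)\<in>Pair i ` X. c i z \<noteq> c i w"
    using uncovered[of "Pair i ` X"] i X by auto
  obtain w where "w \<in> P j" "c i w = c i z" using meets[OF i z(1) j] by blast
  moreover have "c i z \<noteq> c i x" if "x \<in> X" for x using z(2) that by auto
  ultimately show ?thesis by (intro bexI[of _ w]) auto
qed

lemma avoid1:
  "\<lbrakk>i \<in> I; j \<in> {1..r}; x \<in> verts r P\<rbrakk> \<Longrightarrow> \<exists>w\<in>P j. c i w \<noteq> c i x"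
  using avoid[of i j "{x}"] r3 by auto

lemma avoid2:
  "\<lbrakk>i \<in> I; j \<in> {1..r}; x \<in> verts r P; y \<in> verts r P\<rbrakk> \<Longrightarrow> \<exists>w\<in>P j. c i w \<noteq> c i x \<and> c i w \<noteq> c i y"
  using avoid[of i j "{x, y}"] r3 by (auto simp: card_insert_if)

lemma avoid3:
  "\<lbrakk>i \<in> I; j \<in> {1..r}; x \<in> verts r P; y \<in> verts r P; z \<in> verts r P\<rbrakk> \<Longrightarrow>
    \<exists>w\<in>P j. c i w \<noteq> c i x \<and> c i w \<noteq> c i y \<and> c i w \<noteq> c i z"
  using avoid[of i j "{x, y, z}"] r3 by (auto simp: card_insert_if)

lemma class_nonempty: "j \<in> {1..r} \<Longrightarrow> \<exists>x. x \<in> P j"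
proof -
  assume j: "j \<in> {1..r}"
  obtain z where z: "z \<in> verts r P" using uncovered[of "{}"] by auto
  have "I \<noteq> {}" using card_I r3 by auto
  then show ?thesis using meets[OF _ z j] by blast
qed

text \<open>Each class outside \<open>J\<close> can contribute a vertex that destroys one common color.\<close>

lemma card_common_colors:
  assumes "J \<subseteq> {1..r}" "J \<noteq> {}" "\<And>j. j \<in> J \<Longrightarrow> f j \<in> P j"
  shows "r + 1 \<le> card J + card {i\<in>I. \<forall>j\<in>J. \<forall>l\<in>J. c i (f j) = c i (f l)}"
  using assms
proof (induction "r - card J" arbitrary: J f)
  case 0
  have "card {1..r} \<le> card J" using 0 by simp
  then have J: "J = {1..r}" using 0 card_seteq[of "{1..r}" J] by auto
  have "\<exists>i\<in>I. \<forall>j\<in>{1..r}. \<forall>l\<in>{1..r}. c i (f j) = c i (f l)"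
    using agree[of f] 0 J by blast
  then have "{i\<in>I. \<forall>j\<in>J. \<forall>l\<in>J. c i (f j) = c i (f l)} \<noteq> {}" using J by blast
  then have "card {i\<in>I. \<forall>j\<in>J. \<forall>l\<in>J. c i (f j) = c i (f l)} > 0"
    using finite_I by (simp add: card_gt_0_iff)
  then show ?case using J by simp
next
  case (Suc n)
  let ?C = "\<lambda>J f. {i\<in>I. \<forall>j\<in>J. \<forall>l\<in>J. c i (f j) = c i (f l)}"
  have fJ: "finite J" using Suc(3) finite_subset by blast
  have "J \<noteq> {1..r}" using Suc(2) by auto
  then obtain m where m: "m \<in> {1..r}" "m \<notin> J" using Suc(3) by blast
  obtain j0 where j0: "j0 \<in> J" using Suc by blast
  have extend: "r \<le> card J + card (?C (insert m J) (f(m := w)))" if w: "w \<in> P m" for w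
  proof -
    have "(f(m := w)) j \<in> P j" if "j \<in> insert m J" for j
      using that Suc(5) w by auto
    moreover have "n = r - card (insert m J)" using Suc(2) m fJ by simp
    ultimately have "r + 1 \<le> card (insert m J) + card (?C (insert m J) (f(m := w)))"
      using Suc(1)[of "insert m J" "f(m := w)"] Suc(3) m by blast
    then show ?thesis using m fJ by simp
  qed
  have sub: "?C (insert m J) (f(m := w)) \<subseteq> ?C J f" for w
  proof
    fix i assume i: "i \<in> ?C (insert m J) (f(m := w))"
    have f: "(f(m := w)) j = f j" if "j \<in> J" for j using m that by auto
    have "c i (f j) = c i (f l)" if "j \<in> J" "l \<in> J" for j l
    proof -
      have "c i ((f(m := w)) j) = c i ((f(m := w)) l)" using i that by blast
      then show ?thesis unfolding f[OF that(1)] f[OF that(2)] .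
    qed
    then show "i \<in> ?C J f" using i by blast
  qed
  show ?case
  proof (cases "?C J f = {}")
    \<comment> \<open>An empty set of common colors cannot shrink. It stays empty after the
      extension, and \<open>extend\<close> then gives \<open>r \<le> card J\<close>, contrary to
      \<open>Suc n = r - card J\<close>.\<close>
    case True
    obtain w where "w \<in> P m" using class_nonempty m by blast
    moreover have "?C (insert m J) (f(m := w)) = {}" using sub[of w] True by blast
    ultimately have "r \<le> card J" using extend[of w] by (metis (no_types, lifting) add_0_right card.empty)
    then show ?thesis using Suc(2) by simp
  next
    case False
    then obtain i where i: "i \<in> ?C J f" by blast
    obtain w where w: "w \<in> P m" "c i w \<noteq> c i (f j0)"
      using avoid1[of i m "f j0"] i m j0 Suc(3,5) vertsI by blast
    have "i \<notin> ?C (insert m J) (f(m := w))"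
    proof
      assume "i \<in> ?C (insert m J) (f(m := w))"
      then have "c i ((f(m := w)) m) = c i ((f(m := w)) j0)" using j0 by blast
      moreover have "j0 \<noteq> m" using j0 m by blast
      ultimately show False using w(2) by simp
    qed
    then have "?C (insert m J) (f(m := w)) \<subset> ?C J f" using sub[of w] i by blast
    then have "card (?C (insert m J) (f(m := w))) < card (?C J f)"
      using finite_I by (intro psubset_card_mono) auto
    then show ?thesis using extend[OF w(1)] by linarith
  qed
qed

lemma card_common2:
  assumes "p \<in> {1..r}" "q \<in> {1..r}" "p \<noteq> q" "x \<in> P p" "y \<in> P q"
  shows "r - 1 \<le> card {i\<in>I. c i x = c i y}"
proof -
  have *: "{i\<in>I. \<forall>j\<in>{p, q}. \<forall>l\<in>{p, q}. c i (((\<lambda>_. x)(q := y)) j) = c i (((\<lambda>_. x)(q := y)) l)}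
    = {i\<in>I. c i x = c i y}"
    using assms(3) by auto
  have "((\<lambda>_. x)(q := y)) j \<in> P j" if "j \<in> {p, q}" for j
    using that assms by auto
  then have "r + 1 \<le> card {p, q} + card {i\<in>I. c i x = c i y}"
    using card_common_colors[of "{p, q}" "(\<lambda>_. x)(q := y)"] assms unfolding * by blast
  then show ?thesis using assms by simp
qed

lemma card_common3:
  assumes "p \<in> {1..r}" "q \<in> {1..r}" "s \<in> {1..r}" "p \<noteq> q" "p \<noteq> s" "q \<noteq> s"
    "x \<in> P p" "y \<in> P q" "z \<in> P s"
  shows "r - 2 \<le> card {i\<in>I. c i x = c i y \<and> c i x = c i z}"
proof -
  let ?f = "(\<lambda>_. x)(q := y, s := z)"
  have *: "{i\<in>I. \<forall>j\<in>{p, q, s}. \<forall>l\<in>{p, q, s}. c i (?f j) = c i (?f l)}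
    = {i\<in>I. c i x = c i y \<and> c i x = c i z}"
    using assms(4-6) by auto
  have "?f j \<in> P j" if "j \<in> {p, q, s}" for j
    using that assms by auto
  then have "r + 1 \<le> card {p, q, s} + card {i\<in>I. c i x = c i y \<and> c i x = c i z}"
    using card_common_colors[of "{p, q, s}" ?f] assms unfolding * by blast
  then show ?thesis using assms by simp
qed

section \<open>Pairs of vertices with as few common colors as possible\<close>

text \<open>By \<open>card_common2\<close>, \<open>r - 1\<close> is the least possible number of
  common colors for two vertices of different classes.\<close>

definition minimal_pair where
  "minimal_pair p q v u \<longleftrightarrow> p \<in> {1..r} \<and> q \<in> {1..r} \<and> p \<noteq> q \<and> v \<in> P p \<and> u \<in> P q \<and>
     card {i\<in>I. c i v = c i u} = r - 1"

lemma minimal_pair_sym: "minimal_pair p q v u \<Longrightarrow> minimal_pair q p u v"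
proof -
  have "{i\<in>I. c i v = c i u} = {i\<in>I. c i u = c i v}" by auto
  then show "minimal_pair p q v u \<Longrightarrow> minimal_pair q p u v"
    by (simp add: minimal_pair_def)
qed

text \<open>If a pair shares at least \<open>r\<close> colors, a vertex outside its components in
  \<open>r\<close> of them shares at most the other \<open>r - 1\<close> colors with either member,
  and its class differs from that of one of them.\<close>

lemma minimal_pair_exists: "\<exists>p q v u. minimal_pair p q v u"
proof -
  have 12: "1 \<in> {1..r}" "2 \<in> {1..r}" "(1::nat) \<noteq> 2" using r3 by auto
  obtain v v' where v: "v \<in> P 1" "v' \<in> P 2" using class_nonempty 12 by blast
  note ge = card_common2[OF 12 v]
  show ?thesis
  proof (cases "card {i\<in>I. c i v = c i v'} = r - 1")
    case True
    then show ?thesis using 12 v unfolding minimal_pair_def by blast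
  next
    case False
    then have "r \<le> card {i\<in>I. c i v = c i v'}" using ge by simp
    then obtain S where S: "S \<subseteq> {i\<in>I. c i v = c i v'}" "card S = r"
      by (rule obtain_subset_with_card_n)
    have fin: "finite S" using S(1) finite_I by (auto intro: finite_subset)
    have "(\<lambda>i. (i, v)) ` S \<subseteq> I \<times> verts r P" using S(1) v(1) 12(1) vertsI by blast
    moreover have "card ((\<lambda>i. (i, v)) ` S) \<le> r"
      using card_image_le[OF fin, of "\<lambda>i. (i, v)"] S(2) by simp
    ultimately obtain z where z: "z \<in> verts r P" "\<forall>(i, w)\<in>(\<lambda>i. (i, v)) ` S. c i z \<noteq> c i w"
      using uncovered by blast
    then have "c i z \<noteq> c i v" if "i \<in> S" for i using that by auto
    moreover have "c i v = c i v'" if "i \<in> S" for i using that S(1) by blast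
    ultimately have zS: "c i z \<noteq> c i v" "c i z \<noteq> c i v'" if "i \<in> S" for i
      using that by metis+
    obtain m where m: "m \<in> {1..r}" "z \<in> P m" using z by (auto simp: verts_def)
    have *: "card {i\<in>I. c i z = c i y} \<le> r - 1" if "y \<in> {v, v'}" for y
    proof -
      have "{i\<in>I. c i z = c i y} \<subseteq> I - S" using that zS by auto
      then have "card {i\<in>I. c i z = c i y} \<le> card (I - S)"
        using finite_I by (intro card_mono) auto
      also have "\<dots> = r - 1"
        using S card_Diff_subset[OF fin, of I] card_I by auto
      finally show ?thesis .
    qed
    show ?thesis
    proof (cases "m = 1")
      case True
      then have "m \<noteq> 2" by simp
      then have "minimal_pair m 2 z v'"
        using *[of v'] card_common2[OF m(1) 12(2) _ m(2) v(2)] m v 12 by (simp add: minimal_pair_def)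
      then show ?thesis by blast
    next
      case False
      then have "minimal_pair m 1 z v"
        using *[of v] card_common2[OF m(1) 12(1) _ m(2) v(1)] m v 12 by (simp add: minimal_pair_def)
      then show ?thesis by blast
    qed
  qed
qed

text \<open>The three vertices share at least \<open>r - 2\<close> of the \<open>r - 1\<close>
  colors common to \<open>v\<close> and \<open>u\<close>, so \<open>w\<close> leaves at most one of
  them.\<close>

lemma minimal_pair_third:
  assumes mp: "minimal_pair p q v u" and s: "s \<in> {1..r}" "s \<noteq> p" "s \<noteq> q" "w \<in> P s"
    and ab: "a \<in> I" "b \<in> I" "c a v = c a u" "c b v = c b u" "a \<noteq> b"
  shows "c a w = c a v \<or> c b w = c b v"
proof (rule ccontr)
  assume "\<not> ?thesis"
  then have "{i\<in>I. c i v = c i u \<and> c i v = c i w} \<subseteq> {i\<in>I. c i v = c i u} - {a, b}" by auto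
  then have "card {i\<in>I. c i v = c i u \<and> c i v = c i w} \<le> card ({i\<in>I. c i v = c i u} - {a, b})"
    using finite_I by (intro card_mono) auto
  also have "\<dots> = (r - 1) - 2"
    using mp ab by (subst card_Diff_subset) (auto simp: minimal_pair_def)
  finally show False
    using card_common3[of p q s v u w] mp s r3 by (auto simp: minimal_pair_def)
qed

lemma third_class: "\<exists>s\<in>{1..r}. s \<noteq> p \<and> s \<noteq> q"
proof -
  have "\<not> {1..r} \<subseteq> {p, q}" using r3 card_mono[of "{p, q}" "{1..r}"] card_insert_le_m1[of 2 "{q}" p] by auto
  then show ?thesis by blast
qed

lemma card_disagree:
  "minimal_pair p q v u \<Longrightarrow> card {i\<in>I. c i v \<noteq> c i u} = r"
proof -
  assume mp: "minimal_pair p q v u"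
  have "{i\<in>I. c i v \<noteq> c i u} = I - {i\<in>I. c i v = c i u}" by auto
  then show ?thesis using mp card_I finite_I r3
    by (simp add: card_Diff_subset minimal_pair_def)
qed

section \<open>Vertices that avoid a minimal pair in all its common colors\<close>

text \<open>This supplies the last of the \<open>r\<close> components in
  \<open>missed_vertex\<close>. If it fails, each color \<open>j\<close> of \<open>B\<close> has a
  counterexample \<open>x j\<close>, and some third-class vertex shares at most \<open>r - 2\<close>
  colors with one of them, against \<open>card_common2\<close>.\<close>

lemma missed_class_one_component:
  assumes mp: "minimal_pair p q v u"
  shows "\<exists>i\<in>I. \<forall>x\<in>P p. (\<forall>a\<in>I. c a v = c a u \<longrightarrow> c a x \<noteq> c a u) \<longrightarrow> c i x = c i u"
proof (rule ccontr)
  assume neg: "\<not> ?thesis"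
  define A where "A = {i\<in>I. c i v = c i u}"
  define B where "B = {i\<in>I. c i v \<noteq> c i u}"
  note pq = mp[unfolded minimal_pair_def]
  have AB: "A \<union> B = I" "A \<inter> B = {}" "card A = r - 1" "card B = r"
    "finite A" "finite B"
    using card_disagree[OF mp] pq finite_I by (auto simp: A_def B_def)
  have "\<exists>x\<in>P p. (\<forall>a\<in>A. c a x \<noteq> c a u) \<and> c j x \<noteq> c j u" if "j \<in> B" for j
    using neg that unfolding A_def B_def by blast
  then obtain x where x: "\<And>j. j \<in> B \<Longrightarrow> x j \<in> P p" "\<And>j a. \<lbrakk>j \<in> B; a \<in> A\<rbrakk> \<Longrightarrow> c a (x j) \<noteq> c a u"
    "\<And>j. j \<in> B \<Longrightarrow> c j (x j) \<noteq> c j u" by metis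
  \<comment> \<open>\<open>x j\<close> and \<open>u\<close> differ on \<open>A\<close> and in
    \<open>j\<close>, which leaves only the \<open>r - 1\<close> colors \<open>B - {j}\<close>; by
    \<open>card_common2\<close> they share all of these.\<close>
  have xc: "{i\<in>I. c i (x j) = c i u} = B - {j}" if j: "j \<in> B" for j
  proof (rule card_seteq)
    show "finite (B - {j})" using AB by simp
    show "{i\<in>I. c i (x j) = c i u} \<subseteq> B - {j}" using x j AB by blast
    show "card (B - {j}) \<le> card {i\<in>I. c i (x j) = c i u}"
      using AB j card_common2[of p q "x j" u] pq x by simp
  qed
  then have mpx: "minimal_pair p q (x j) u" if j: "j \<in> B" for j
    using that pq x AB by (simp add: minimal_pair_def)
  obtain s where s: "s \<in> {1..r}" "s \<noteq> p" "s \<noteq> q" using third_class by blast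
  \<comment> \<open>The pairs \<open>(x l, u)\<close> are minimal with common colors \<open>B - {l}\<close>, which confines the third classes.\<close>
  have near: "c i w = c i u \<or> c j w = c j u" if "i \<in> B" "j \<in> B" "i \<noteq> j" "w \<in> P s" for i j w
  proof -
    have "\<not> B \<subseteq> {i, j}" using AB r3 card_mono[of "{i, j}" B] that by auto
    then obtain l where l: "l \<in> B" "l \<noteq> i" "l \<noteq> j" by blast
    have "c i (x l) = c i u" "c j (x l) = c j u" using xc[OF l(1)] that l by auto
    then show ?thesis
      using minimal_pair_third[OF mpx[OF l(1)] s that(4), of i j] that AB by auto
  qed
  obtain j1 j2 where j: "j1 \<in> B" "j2 \<in> B" "j1 \<noteq> j2"
  proof -
    have "\<not> card B \<le> 1" using AB r3 by simp
    then show ?thesis using that AB card_le_Suc0_iff_eq[of B] by auto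
  qed
  obtain a where a: "a \<in> A" using AB r3 by fastforce
  have vx: "u \<in> verts r P" "x j1 \<in> verts r P" "x j2 \<in> verts r P"
    using vertsI pq x j by blast+
  \<comment> \<open>Avoiding both \<open>x j1\<close> and \<open>x j2\<close> leaves a choice of
    \<open>l\<close> different from the color \<open>i\<close> found below.\<close>
  obtain w where w: "w \<in> P s" "c a w \<noteq> c a u" "c a w \<noteq> c a (x j1)" "c a w \<noteq> c a (x j2)"
    using avoid3[OF _ s(1) vx, of a] a AB by blast
  have wA: "c b w = c b u" if "b \<in> A" "b \<noteq> a" for b
    using minimal_pair_third[OF mp s w(1), of a b] a that w by (auto simp: A_def)
  obtain i where i: "i \<in> B" "c i w = c i v"
  proof -
    have "\<not> {i\<in>I. c i v = c i w} \<subseteq> A - {a}"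
    proof
      assume "{i\<in>I. c i v = c i w} \<subseteq> A - {a}"
      then have "card {i\<in>I. c i v = c i w} \<le> card (A - {a})" using AB by (intro card_mono) auto
      then show False using card_common2[OF _ s(1) s(2)[symmetric] _ w(1), of v] pq AB a r3 by auto
    qed
    then obtain i where "i \<in> I" "c i v = c i w" "i \<notin> A - {a}" by blast
    moreover have "i \<noteq> a" using calculation a w by (auto simp: A_def)
    ultimately show ?thesis using that AB by auto
  qed
  then have iu: "c i w \<noteq> c i u" by (simp add: B_def)
  obtain l where l: "l \<in> B" "l \<noteq> i" "c a w \<noteq> c a (x l)" using j w by metis
  \<comment> \<open>On \<open>A\<close> except \<open>a\<close>, \<open>w\<close> agrees with
    \<open>u\<close> while \<open>x l\<close> does not; \<open>a\<close> is excluded by the choice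
    of \<open>l\<close>. In \<open>i\<close>, \<open>x l\<close> agrees with \<open>u\<close> and
    \<open>w\<close> does not; in \<open>l\<close> it is the other way round.\<close>
  have "{m\<in>I. c m (x l) = c m w} \<subseteq> B - {i, l}"
  proof
    fix m assume m: "m \<in> {m\<in>I. c m (x l) = c m w}"
    have "m \<notin> A"
    proof
      assume "m \<in> A"
      moreover have "m \<noteq> a" using m l(3) by auto
      ultimately show False using m wA[of m] x(2)[OF l(1)] by auto
    qed
    then have "m \<in> B" using m AB(1) by blast
    moreover have "i \<in> {i\<in>I. c i (x l) = c i u}" unfolding xc[OF l(1)] using i l by blast
    then have "m \<noteq> i" using m iu by auto
    moreover have "m \<noteq> l"
      using near[OF l(1) i(1) l(2) w(1)] iu m x(3)[OF l(1)] by auto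
    ultimately show "m \<in> B - {i, l}" by simp
  qed
  then have "card {m\<in>I. c m (x l) = c m w} \<le> card (B - {i, l})" using AB by (intro card_mono) auto
  also have "\<dots> = r - 2" using AB i l by (subst card_Diff_subset) auto
  finally show False using card_common2[OF _ s(1) s(2)[symmetric] _ w(1), of "x l"] pq x(1) l(1) r3 by auto
qed

text \<open>Otherwise the components of \<open>v\<close> in the \<open>r - 1\<close> common colors
  and one component of \<open>u\<close> form a cover. The former contain class \<open>q\<close> and,
  by \<open>minimal_pair_third\<close>, every third class; what they miss of class \<open>p\<close>
  lies in the component of \<open>u\<close> from \<open>missed_class_one_component\<close>.\<close>

lemma missed_vertex:
  assumes mp: "minimal_pair p q v u"
  shows "\<exists>y\<in>P q. \<forall>a\<in>I. c a v = c a u \<longrightarrow> c a y \<noteq> c a v"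
proof (rule ccontr)
  assume neg: "\<not> ?thesis"
  note pq = mp[unfolded minimal_pair_def]
  obtain i where i: "i \<in> I"
    "\<And>x. \<lbrakk>x \<in> P p; \<And>a. \<lbrakk>a \<in> I; c a v = c a u\<rbrakk> \<Longrightarrow> c a x \<noteq> c a u\<rbrakk> \<Longrightarrow> c i x = c i u"
    using missed_class_one_component[OF mp] by blast
  define A where "A = {i\<in>I. c i v = c i u}"
  define T where "T = insert (i, u) ((\<lambda>a. (a, v)) ` A)"
  have A: "finite A" "card A = r - 1" using pq finite_I by (auto simp: A_def)
  have "card T \<le> Suc (card ((\<lambda>a. (a, v)) ` A))"
    unfolding T_def using A by (intro card_insert_le_m1) auto
  also have "\<dots> \<le> r" using card_image_le[OF A(1), of "\<lambda>a. (a, v)"] A(2) r3 by simp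
  finally have "card T \<le> r" .
  moreover have "T \<subseteq> I \<times> verts r P" using pq i vertsI by (auto simp: T_def A_def)
  ultimately obtain z where z: "z \<in> verts r P" "\<forall>(i, w)\<in>T. c i z \<noteq> c i w"
    using uncovered by blast
  have zA: "c a z \<noteq> c a v" if "a \<in> A" for a using z(2) that by (auto simp: T_def)
  have zi: "c i z \<noteq> c i u" using z(2) by (auto simp: T_def)
  obtain m where m: "m \<in> {1..r}" "z \<in> P m" using z by (auto simp: verts_def)
  have "m \<noteq> p" using i(2)[of z] m zi zA by (auto simp: A_def)
  moreover have "m \<noteq> q" using neg m zA by (auto simp: A_def)
  moreover obtain a b where "a \<in> A" "b \<in> A" "a \<noteq> b"
  proof -
    have "\<not> card A \<le> 1" using A r3 by simp
    then show ?thesis using that A card_le_Suc0_iff_eq[of A] by auto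
  qed
  ultimately show False
    using minimal_pair_third[OF mp m(1) _ _ m(2), of a b] zA by (auto simp: A_def)
qed

text \<open>\<open>x\<close> avoids \<open>u\<close> in every color common to \<open>v\<close> and
  \<open>u\<close>, so the colors shared by \<open>x\<close>, \<open>u\<close> and \<open>w\<close>,
  at least \<open>r - 2\<close> in number, lie among the others.\<close>

lemma third_agreement:
  assumes mp: "minimal_pair p q v u" and s: "s \<in> {1..r}" "s \<noteq> p" "s \<noteq> q" "w \<in> P s"
    and x: "x \<in> P p" "\<And>a. \<lbrakk>a \<in> I; c a v = c a u\<rbrakk> \<Longrightarrow> c a x \<noteq> c a u"
  shows "r - 2 \<le> card {i\<in>I. c i v \<noteq> c i u \<and> c i w = c i u}"
proof -
  have "r - 2 \<le> card {i\<in>I. c i x = c i u \<and> c i x = c i w}"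
    using card_common3[of p q s x u w] mp s x by (auto simp: minimal_pair_def)
  also have "\<dots> \<le> card {i\<in>I. c i v \<noteq> c i u \<and> c i w = c i u}"
    using x finite_I by (intro card_mono) auto
  finally show ?thesis .
qed

text \<open>A third-class vertex avoiding \<open>u\<close> and \<open>v\<close> in a color
  \<open>i\<close> of \<open>B\<close> shares at least \<open>r - 2\<close> colors of
  \<open>B - {i}\<close> with \<open>u\<close> and at least \<open>r - 2\<close> others with
  \<open>v\<close>, so \<open>2 * (r - 2) \<le> r - 1\<close>.\<close>

lemma r_eq_3: "r = 3"
proof -
  obtain p q v u where mp: "minimal_pair p q v u" using minimal_pair_exists by blast
  note pq = mp[unfolded minimal_pair_def]
  obtain y where y: "y \<in> P q" "\<And>a. \<lbrakk>a \<in> I; c a u = c a v\<rbrakk> \<Longrightarrow> c a y \<noteq> c a v"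
    using missed_vertex[OF mp] by metis
  obtain x where x: "x \<in> P p" "\<And>a. \<lbrakk>a \<in> I; c a v = c a u\<rbrakk> \<Longrightarrow> c a x \<noteq> c a u"
    using missed_vertex[OF minimal_pair_sym[OF mp]] by metis
  obtain s where s: "s \<in> {1..r}" "s \<noteq> p" "s \<noteq> q" using third_class by blast
  define B where "B = {i\<in>I. c i v \<noteq> c i u}"
  have B: "card B = r" "finite B" using card_disagree[OF mp] finite_I by (auto simp: B_def)
  then obtain i where i: "i \<in> B" using r3 by fastforce
  have vx: "u \<in> verts r P" "v \<in> verts r P"
    using vertsI pq by blast+
  obtain w where w: "w \<in> P s" "c i w \<noteq> c i u" "c i w \<noteq> c i v"
    using avoid2[OF _ s(1) vx, of i] i by (auto simp: B_def)
  have "2 * (r - 2) \<le> card {i\<in>I. c i v \<noteq> c i u \<and> c i w = c i u} + card {i\<in>I. c i u \<noteq> c i v \<and> c i w = c i v}"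
    using third_agreement[OF mp s w(1) x] 
      third_agreement[OF minimal_pair_sym[OF mp] s(1,3,2) w(1) y] by linarith
  also have "\<dots> = card ({i\<in>I. c i v \<noteq> c i u \<and> c i w = c i u} \<union> {i\<in>I. c i u \<noteq> c i v \<and> c i w = c i v})"
    using finite_I by (intro card_Un_disjoint[symmetric]) auto
  also have "\<dots> \<le> card (B - {i})"
    using w B by (intro card_mono) (auto simp: B_def)
  also have "\<dots> = r - 1" using B i by simp
  finally show ?thesis using r3 by linarith
qed

section \<open>The case \<open>r = 3\<close>\<close>

lemma common3:
  assumes "p \<in> {1..r}" "q \<in> {1..r}" "s \<in> {1..r}" "p \<noteq> q" "p \<noteq> s" "q \<noteq> s"
    "x \<in> P p" "y \<in> P q" "z \<in> P s"
  shows "\<exists>i\<in>I. c i x = c i y \<and> c i x = c i z"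
proof (rule ccontr)
  assume "\<not> ?thesis"
  then have "{i\<in>I. c i x = c i y \<and> c i x = c i z} = {}" by blast
  then show False using card_common3[OF assms] r3 by (simp only: card.empty)
qed

text \<open>On the colors \<open>b1, b2, b3, a1, a2\<close>, with the components of \<open>v\<close> numbered 0 and those of
  \<open>u\<close> in \<open>b1, b2, b3\<close> numbered 1, the four vertices are
  \<open>v = (0,0,0,0,0)\<close>, \<open>u = (1,1,1,0,0)\<close>, \<open>x = (0,1,1,*,*)\<close>, \<open>y = (0,0,?,*,*)\<close>,
  where \<open>*\<close> is nonzero.\<close>

lemma no_five_color_configuration:
  assumes r: "r = 3" and classes: "p \<in> {1..r}" "q \<in> {1..r}" "s \<in> {1..r}" "p \<noteq> q" "p \<noteq> s" "q \<noteq> s"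
    and I: "I = {b1, b2, b3, a1, a2}"
    and mem: "v \<in> P p" "u \<in> P q" "x \<in> P p" "y \<in> P q"
    and vu: "c b1 v \<noteq> c b1 u" "c b2 v \<noteq> c b2 u" "c b3 v \<noteq> c b3 u"
      "c a1 u = c a1 v" "c a2 u = c a2 v"
    and x: "c b1 x = c b1 v" "c b2 x = c b2 u" "c b3 x = c b3 u" "c a1 x \<noteq> c a1 v" "c a2 x \<noteq> c a2 v"
    and y: "c b1 y = c b1 v" "c b2 y = c b2 v" "c a1 y \<noteq> c a1 v" "c a2 y \<noteq> c a2 v"
  shows False
proof -
  have D: "(c b1 f = c b1 g \<and> c b1 f = c b1 w) \<or> (c b2 f = c b2 g \<and> c b2 f = c b2 w) \<or>
      (c b3 f = c b3 g \<and> c b3 f = c b3 w) \<or> (c a1 f = c a1 g \<and> c a1 f = c a1 w) \<or>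
      (c a2 f = c a2 g \<and> c a2 f = c a2 w)"
    if "f \<in> P p" "g \<in> P q" "w \<in> P s" for f g w
    using common3[OF classes that] unfolding I by blast
  have "card {p, q, s} = 3" using classes by simp
  then have pqs: "{p, q, s} = {1..r}"
    using classes r by (intro card_seteq) auto
  have verts: "z \<in> P p \<or> z \<in> P q \<or> z \<in> P s" if "z \<in> verts r P" for z
    using that unfolding verts_def pqs[symmetric] by auto
  have cover: "\<exists>z. (z \<in> P p \<or> z \<in> P q \<or> z \<in> P s) \<and> c i z \<noteq> c i f \<and> c j z \<noteq> c j g \<and> c k z \<noteq> c k h"
    if "i \<in> I" "j \<in> I" "k \<in> I" "f \<in> {u, v}" "g \<in> {u, v}" "h \<in> {u, v}" for i j k f g h
  proof -
    have "card {(i, f), (j, g), (k, h)} \<le> r" using r by (simp add: card_insert_if)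
    moreover have "{(i, f), (j, g), (k, h)} \<subseteq> I \<times> verts r P"
      using that mem classes vertsI by blast
    ultimately show ?thesis using uncovered[of "{(i, f), (j, g), (k, h)}"] verts by auto
  qed
  have vx: "v \<in> verts r P" "u \<in> verts r P" "x \<in> verts r P"
    using vertsI mem classes by blast+
  \<comment> \<open>The constraints \<open>wa\<close>, \<open>wu\<close> and \<open>wv\<close> on
    third-class vertices come from the pairs \<open>v\<close>, \<open>u\<close>, then
    \<open>x\<close>, \<open>u\<close>, then \<open>v\<close>, \<open>y\<close>.\<close>
  have wa: "c a1 w = c a1 v \<or> c a2 w = c a2 v" if "w \<in> P s" for w
    using D[OF mem(1,2) that] vu by metis
  have wu: "c b2 w = c b2 u \<or> c b3 w = c b3 u" if "w \<in> P s" for w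
    using D[OF mem(3,2) that] vu x by metis
  have wv: "c b1 w = c b1 v \<or> c b2 w = c b2 v \<or> c b3 y = c b3 v \<and> c b3 w = c b3 v" if "w \<in> P s" for w
    using D[OF mem(1,4) that] y by metis
  obtain w where w: "w \<in> P s" "c b2 w \<noteq> c b2 v" "c b2 w \<noteq> c b2 u"
    using avoid2[OF _ classes(3) vx(1,2), of b2] I by blast
  have w3: "c b3 w = c b3 u" using wu[OF w(1)] w by metis
  then have w1: "c b1 w = c b1 v" using wv[OF w(1)] w vu by metis
  show False
  proof (cases "c b3 y = c b3 v")
    case False
    \<comment> \<open>A vertex outside the components of \<open>v\<close> in \<open>b1\<close>, of
      \<open>u\<close> in \<open>b3\<close> and of \<open>v\<close> in \<open>a1\<close> forces
      \<open>w\<close> to agree with \<open>v\<close> in \<open>a2\<close> but not in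
      \<open>a1\<close>. Exchanging \<open>a1\<close> and \<open>a2\<close> forces the
      opposite.\<close>
    have 1: "c a2 w = c a2 v \<and> c a1 w \<noteq> c a1 v"
    proof -
      obtain z where z: "z \<in> P p \<or> z \<in> P q \<or> z \<in> P s" "c b1 z \<noteq> c b1 v" "c b3 z \<noteq> c b3 u" "c a1 z \<noteq> c a1 v"
        using cover[of b1 b3 a1 v u v] I by blast
      from z(1) show ?thesis
      proof (elim disjE)
        assume "z \<in> P p"
        then show ?thesis using D[of z u w] D[of z y w] mem w w1 w3 z(2-4) vu y by metis
      next
        assume "z \<in> P q"
        then show ?thesis using D[of v z w] D[of x z w] mem w w1 w3 z(2-4) vu x by metis
      next
        assume "z \<in> P s"
        then show ?thesis using wu[of z] wv[of z] z(2-4) False vu by metis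
      qed
    qed
    have 2: "c a1 w = c a1 v \<and> c a2 w \<noteq> c a2 v"
    proof -
      obtain z where z: "z \<in> P p \<or> z \<in> P q \<or> z \<in> P s" "c b1 z \<noteq> c b1 v" "c b3 z \<noteq> c b3 u" "c a2 z \<noteq> c a2 v"
        using cover[of b1 b3 a2 v u v] I by blast
      from z(1) show ?thesis
      proof (elim disjE)
        assume "z \<in> P p"
        then show ?thesis using D[of z u w] D[of z y w] mem w w1 w3 z(2-4) vu y by metis
      next
        assume "z \<in> P q"
        then show ?thesis using D[of v z w] D[of x z w] mem w w1 w3 z(2-4) vu x by metis
      next
        assume "z \<in> P s"
        then show ?thesis using wu[of z] wv[of z] z(2-4) False vu by metis
      qed
    qed
    from 1 2 show False by blast
  next
    case True
    \<comment> \<open>Now \<open>y\<close> agrees with \<open>v\<close> in \<open>b1\<close>,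
      \<open>b2\<close> and \<open>b3\<close>, and the components of \<open>v\<close> in
      \<open>b1\<close> and of \<open>u\<close> in \<open>b2\<close> and \<open>b3\<close> cover;
      \<open>w4\<close> and \<open>w5\<close> serve to rule out a missed vertex of class
      \<open>p\<close> or \<open>q\<close>.\<close>
    obtain z where z: "z \<in> P p \<or> z \<in> P q \<or> z \<in> P s" "c b1 z \<noteq> c b1 v" "c b2 z \<noteq> c b2 u" "c b3 z \<noteq> c b3 u"
      using cover[of b1 b2 b3 v u u] I by blast
    obtain w4 where w4: "w4 \<in> P s" "c a1 w4 \<noteq> c a1 v" "c a1 w4 \<noteq> c a1 x"
      using avoid2[OF _ classes(3) vx(1,3), of a1] I by blast
    obtain w5 where w5: "w5 \<in> P s" "c a2 w5 \<noteq> c a2 v" "c a2 w5 \<noteq> c a2 x"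
      using avoid2[OF _ classes(3) vx(1,3), of a2] I by blast
    have wA: "c a2 w4 = c a2 v" "c a1 w5 = c a1 v" using wa w4 w5 by metis+
    from z(1) show False
    proof (elim disjE)
      assume zp: "z \<in> P p"
      have "c b1 w4 = c b1 v" "c b1 w5 = c b1 v"
        using D[OF mem(3,4) w4(1)] D[OF mem(3,4) w5(1)] w4 w5 wA x y True vu by metis+
      then have "c a1 z = c a1 v" "c a2 z = c a2 v"
        using D[OF zp mem(2) w5(1)] D[OF zp mem(2) w4(1)] w4 w5 wA z(2-4) vu by metis+
      then show False using D[OF zp mem(4) w(1)] w w1 w3 z(2-4) y True vu by metis
    next
      assume "z \<in> P q"
      then show False using D[OF mem(3) _ w5(1), of z] w5 wA x z(2-4) by metis
    next
      assume "z \<in> P s"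
      then show False using wu z(2-4) by metis
    qed
  qed
qed

text \<open>For \<open>r = 3\<close>, \<open>x\<close> agrees with \<open>u\<close>, and
  \<open>y\<close> with \<open>v\<close>, in at least two of the three colors of \<open>B\<close>. A
  color \<open>\<beta>\<close> of \<open>B\<close> where \<open>x\<close> and \<open>y\<close> agree
  leaves three cases: the five-color configuration, the same with \<open>v\<close>, \<open>x\<close>
  and \<open>u\<close>, \<open>y\<close> exchanged, or a direct contradiction.\<close>

lemma contradiction: False
proof -
  obtain p q v u where mp: "minimal_pair p q v u" using minimal_pair_exists by blast
  note pq = mp[unfolded minimal_pair_def]
  obtain y where y: "y \<in> P q" "\<And>a. \<lbrakk>a \<in> I; c a u = c a v\<rbrakk> \<Longrightarrow> c a y \<noteq> c a v"
    using missed_vertex[OF mp] by metis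
  obtain x where x: "x \<in> P p" "\<And>a. \<lbrakk>a \<in> I; c a v = c a u\<rbrakk> \<Longrightarrow> c a x \<noteq> c a u"
    using missed_vertex[OF minimal_pair_sym[OF mp]] by metis
  obtain s where s: "s \<in> {1..r}" "s \<noteq> p" "s \<noteq> q" using third_class by blast
  have classes: "p \<in> {1..r}" "q \<in> {1..r}" "s \<in> {1..r}" "p \<noteq> q" "p \<noteq> s" "q \<noteq> s"
    using pq s by auto
  have mem: "v \<in> P p" "u \<in> P q" using pq by auto
  define A where "A = {i\<in>I. c i v = c i u}"
  define B where "B = {i\<in>I. c i v \<noteq> c i u}"
  have AB: "A \<union> B = I" "card A = 2" "card B = 3"
    using card_disagree[OF mp] pq r_eq_3 by (auto simp: A_def B_def)
  obtain a1 a2 where A: "A = {a1, a2}" using AB(2) card_2_iff[of A] by blast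
  have xu: "c i x = c i u \<or> c j x = c j u" if "i \<in> B" "j \<in> B" "i \<noteq> j" for i j
  proof (rule ccontr)
    assume neg: "\<not> ?thesis"
    have "{m\<in>I. c m x = c m u} \<subseteq> B - {i, j}" using neg x(2) by (auto simp: B_def)
    then have "card {m\<in>I. c m x = c m u} \<le> card (B - {i, j})"
      using finite_I by (intro card_mono) (auto simp: B_def)
    also have "\<dots> = 1" using AB that by (subst card_Diff_subset) auto
    finally show False using card_common2[OF classes(1,2,4) x(1) mem(2)] r_eq_3 by simp
  qed
  have yv: "c i y = c i v \<or> c j y = c j v" if "i \<in> B" "j \<in> B" "i \<noteq> j" for i j
  proof (rule ccontr)
    assume neg: "\<not> ?thesis"
    have "{m\<in>I. c m v = c m y} \<subseteq> B - {i, j}"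
    proof
      fix m assume m: "m \<in> {m\<in>I. c m v = c m y}"
      then have "c m u \<noteq> c m v" using y(2)[of m] by auto
      then show "m \<in> B - {i, j}" using neg m by (auto simp: B_def)
    qed
    then have "card {m\<in>I. c m v = c m y} \<le> card (B - {i, j})"
      using finite_I by (intro card_mono) (auto simp: B_def)
    also have "\<dots> = 1" using AB that by (subst card_Diff_subset) auto
    finally show False using card_common2[OF classes(1,2,4) mem(1) y(1)] r_eq_3 by simp
  qed
  have vx: "v \<in> verts r P" "u \<in> verts r P" "x \<in> verts r P"
    using vertsI mem classes x by blast+
  have aA: "a1 \<in> I" "a2 \<in> I" "c a1 v = c a1 u" "c a2 v = c a2 u" "a1 \<noteq> a2"
    using A AB(2) by (auto simp: A_def card_insert_if split: if_splits)
  \<comment> \<open>If \<open>x\<close> and \<open>y\<close> differ on \<open>B\<close>, the color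
    shared by \<open>x\<close>, \<open>y\<close>, \<open>w\<close> is \<open>a1\<close> or
    \<open>a2\<close>. But \<open>w\<close> avoids \<open>x\<close> in \<open>a1\<close>, and in
    \<open>a2\<close> it agrees with \<open>v\<close>, which \<open>x\<close> avoids.\<close>
  obtain \<beta> where \<beta>: "\<beta> \<in> B" "c \<beta> x = c \<beta> y"
  proof (rule ccontr)
    assume "\<not> thesis"
    then have ne: "c i x \<noteq> c i y" if "i \<in> B" for i using that \<open>\<And>\<beta>. \<lbrakk>\<beta> \<in> B; c \<beta> x = c \<beta> y\<rbrakk> \<Longrightarrow> thesis\<close> by blast
    obtain w where w: "w \<in> P s" "c a1 w \<noteq> c a1 v" "c a1 w \<noteq> c a1 x"
      using avoid2[OF aA(1) s(1) vx(1,3)] by blast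
    then have "c a2 w = c a2 v" using minimal_pair_third[OF mp s w(1) aA] by blast
    moreover obtain i where i: "i \<in> I" "c i x = c i y" "c i x = c i w"
      using common3[OF classes x(1) y(1) w(1)] by blast
    moreover have "i \<in> A" using i ne AB(1) by blast
    ultimately show False using A aA w x(2)[of a2] by auto
  qed
  obtain j k where jk: "B = {\<beta>, j, k}" "\<beta> \<noteq> j" "\<beta> \<noteq> k" "j \<noteq> k"
  proof -
    have "card (B - {\<beta>}) = 2" using AB \<beta> by simp
    then obtain j k where "B - {\<beta>} = {j, k}" "j \<noteq> k" using card_2_iff[of "B - {\<beta>}"] by blast
    then show ?thesis using that[of j k] \<beta>(1) by blast
  qed
  have I1: "I = {\<beta>, j, k, a1, a2}" and I2: "I = {\<beta>, k, j, a1, a2}"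
    using AB(1) A jk(1) by auto
  have B: "c \<beta> v \<noteq> c \<beta> u" "c j v \<noteq> c j u" "c k v \<noteq> c k u" using jk(1) by (auto simp: B_def)
  have xA: "c a1 x \<noteq> c a1 v" "c a2 x \<noteq> c a2 v" "c a1 y \<noteq> c a1 v" "c a2 y \<noteq> c a2 v"
    using x(2) y(2) aA by metis+
  have jkB: "\<beta> \<in> B" "j \<in> B" "k \<in> B" using jk(1) by auto
  consider "c \<beta> x = c \<beta> v" | "c \<beta> x = c \<beta> u" | "c \<beta> x \<noteq> c \<beta> v" "c \<beta> x \<noteq> c \<beta> u" by blast
  then show False
  proof cases
    case 1
    then have xjk: "c j x = c j u" "c k x = c k u" using xu jkB jk B by metis+
    show False
    proof (cases "c j y = c j v")
      case True
      show False
        by (rule no_five_color_configuration[OF r_eq_3 classes I1 mem x(1) y(1)])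
          (use B aA xA 1 \<beta> xjk True in auto)
    next
      case False
      then have "c k y = c k v" using yv jkB jk by metis
      then show False
        by (intro no_five_color_configuration[OF r_eq_3 classes I2 mem x(1) y(1)])
          (use B aA xA 1 \<beta> xjk in auto)
    qed
  next
    case 2
    then have yjk: "c j y = c j v" "c k y = c k v" using yv jkB jk B \<beta> by metis+
    note classes' = classes(2,1,3) classes(4)[symmetric] classes(6,5)
    show False
    proof (cases "c j x = c j u")
      case True
      show False
        by (rule no_five_color_configuration[OF r_eq_3 classes' I1 mem(2,1) y(1) x(1)])
          (use B aA xA 2 \<beta> yjk True in auto)
    next
      case False
      then have "c k x = c k u" using xu jkB jk by metis
      then show False
        by (intro no_five_color_configuration[OF r_eq_3 classes' I2 mem(2,1) y(1) x(1)])
          (use B aA xA 2 \<beta> yjk in auto)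
    qed
  next
    case 3
    then have xyjk: "c j x = c j u" "c k x = c k u" "c j y = c j v" "c k y = c k v"
      using xu yv jkB jk \<beta> by metis+
    \<comment> \<open>Only color \<open>k\<close> can be shared by \<open>x\<close>,
      \<open>u\<close>, \<open>w\<close>, and only \<open>k\<close> by \<open>v\<close>,
      \<open>y\<close>, \<open>w\<close>, although \<open>v\<close> and \<open>u\<close> differ
      there.\<close>
    obtain w where w: "w \<in> P s" "c j w \<noteq> c j v" "c j w \<noteq> c j u"
      using avoid2[OF _ s(1) vx(1,2), of j] I1 by blast
    obtain i where "i \<in> I" "c i x = c i u" "c i x = c i w"
      using common3[OF classes x(1) mem(2) w(1)] by blast
    then have "c k w = c k u" using I1 3 xA aA w by auto
    moreover obtain i where "i \<in> I" "c i v = c i y" "c i v = c i w"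
      using common3[OF classes mem(1) y(1) w(1)] by blast
    then have "c k w = c k v" using I1 3 xA aA w \<beta> by auto
    ultimately show False using B by simp
  qed
qed

end

subsection \<open>The upper bound\<close>

lemma transversal_in_complete_edges:
  assumes P: "partite_classes r P" and f: "\<And>j. j \<in> {1..r} \<Longrightarrow> f j \<in> P j"
  shows "f ` {1..r} \<in> complete_edges r P"
proof -
  have "f ` {1..r} \<inter> P l = {f l}" if l: "l \<in> {1..r}" for l
  proof -
    have "f m \<notin> P l" if "m \<in> {1..r}" "m \<noteq> l" for m
      using f[OF that(1)] P l that unfolding partite_classes_def disjoint_family_on_def by blast
    then show ?thesis using f[OF l] l by blast
  qed
  then show ?thesis using f by (auto simp: complete_edges_def verts_def)
qed

lemma complete_edges_meet:
  assumes "e \<in> complete_edges r P" "j \<in> {1..r}"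
  shows "\<exists>w\<in>P j. w \<in> e"
proof -
  have "card (e \<inter> P j) = 1" using assms by (simp add: complete_edges_def)
  then have "e \<inter> P j \<noteq> {}" by auto
  then show ?thesis by blast
qed

lemma complete_edges_transversal:
  assumes "e \<in> complete_edges r P"
  obtains f where "\<And>j. j \<in> {1..r} \<Longrightarrow> f j \<in> P j" "e = f ` {1..r}"
proof -
  have "\<forall>j\<in>{1..r}. \<exists>x. e \<inter> P j = {x}"
    using assms by (auto simp: complete_edges_def card_1_singleton_iff)
  then obtain f where f: "\<And>j. j \<in> {1..r} \<Longrightarrow> e \<inter> P j = {f j}" by metis
  have "e = (\<Union>j\<in>{1..r}. e \<inter> P j)" using assms by (auto simp: complete_edges_def verts_def)
  also have "\<dots> = (\<Union>j\<in>{1..r}. {f j})" by (intro SUP_cong refl f)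
  finally have "e = f ` {1..r}" by blast
  moreover have "f j \<in> P j" if "j \<in> {1..r}" for j using f[OF that] by blast
  ultimately show ?thesis by (intro that)
qed

lemma finite_verts: "partite_classes r P \<Longrightarrow> finite (verts r P)"
  by (auto simp: partite_classes_def verts_def)

lemma cover_number_le_r:
  fixes P :: "nat \<Rightarrow> 'a set"
  assumes r: "r \<ge> 3" and P: "partite_classes r P"
    and \<chi>: "edge_coloring (2 * r - 1) (complete_edges r P) \<chi>"
    and span: "spanning (verts r P) (complete_edges r P) \<chi>"
  shows "cover_number (2 * r - 1) (verts r P) (complete_edges r P) \<chi> \<le> r"
proof (rule ccontr)
  let ?k = "2 * r - 1" and ?V = "verts r P" and ?E = "complete_edges r P"
  assume big: "\<not> ?thesis"
  have "\<forall>j\<in>{1..r}. \<exists>x. x \<in> P j" using P unfolding partite_classes_def by blast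
  then obtain f where "\<And>j. j \<in> {1..r} \<Longrightarrow> f j \<in> P j" by metis
  then obtain i0 where i0: "i0 \<in> \<chi> ` ?E" using transversal_in_complete_edges[OF P] by blast
  \<comment> \<open>Unused colors have only singleton components, so each of them is replaced by a copy of a used one.\<close>
  define g where "g i = (if i \<in> \<chi> ` ?E then i else i0)" for i
  define c where "c i v = linked ?V {e \<in> ?E. \<chi> e = g i} `` {v}" for i v
  have c_eq: "c i x = c i y" if "e \<in> ?E" "\<chi> e = g i" "x \<in> e" "y \<in> e" for i e x y
  proof -
    have "(x, y) \<in> linked ?V {e \<in> ?E. \<chi> e = g i}"
      using that edge_sequence_single[of e "{e \<in> ?E. \<chi> e = g i}" x y]
      by (auto simp: linked_def complete_edges_def)
    then show ?thesis unfolding c_def by (rule equiv_class_eq[OF equiv_linked])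
  qed
  have g: "g i \<in> \<chi> ` ?E" for i using i0 by (simp add: g_def)
  have gk: "g i \<in> {1..?k}" for i using g[of i] \<chi> by (auto simp: edge_coloring_def)
  interpret uncoverable r P "{1..?k}" c
  proof
    show "3 \<le> r" "card {1..?k} = ?k" using r by auto
  next
    fix i v j assume "i \<in> {1..?k}" and v: "v \<in> ?V" and j: "j \<in> {1..r}"
    obtain e where e: "e \<in> ?E" "v \<in> e" "\<chi> e = g i"
      using span v g[of i] unfolding spanning_def by blast
    then show "\<exists>w\<in>P j. c i w = c i v" using complete_edges_meet[OF e(1) j] c_eq by blast
  next
    fix f :: "nat \<Rightarrow> 'a" assume "\<And>j. j \<in> {1..r} \<Longrightarrow> f j \<in> P j"
    then have e: "f ` {1..r} \<in> ?E" by (rule transversal_in_complete_edges[OF P])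
    then have "\<chi> (f ` {1..r}) \<in> {1..?k}" "\<chi> (f ` {1..r}) = g (\<chi> (f ` {1..r}))"
      using \<chi> by (auto simp: edge_coloring_def g_def)
    then show "\<exists>i\<in>{1..?k}. \<forall>j\<in>{1..r}. \<forall>l\<in>{1..r}. c i (f j) = c i (f l)"
      using c_eq[OF e] by blast
  next
    fix T assume T: "T \<subseteq> {1..?k} \<times> ?V" "card T \<le> r"
    show "\<exists>z\<in>?V. \<forall>(i, w)\<in>T. c i z \<noteq> c i w"
    proof (rule ccontr)
      assume neg: "\<not> ?thesis"
      have fin: "finite T" using T(1) finite_verts[OF P] by (auto intro: finite_subset)
      define S where "S = (\<lambda>(i, w). c i w) ` T"
      have "c i w \<in> mono_components ?k ?V ?E \<chi>" if "w \<in> ?V" for i w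
        unfolding mono_components_def components_def c_def using gk[of i] that by (intro UN_I[of "g i"] quotientI)
      then have "S \<subseteq> mono_components ?k ?V ?E \<chi>"
        using T(1) by (auto simp: S_def)
      moreover have "?V \<subseteq> \<Union>S"
      proof
        fix z assume z: "z \<in> ?V"
        then have "\<exists>x\<in>T. \<not> (case x of (i, w) \<Rightarrow> c i z \<noteq> c i w)" using neg by blast
        then obtain i w where iw: "(i, w) \<in> T" "c i z = c i w" by auto
        have "z \<in> c i z" unfolding c_def by (rule equiv_class_self[OF equiv_linked z])
        then show "z \<in> \<Union>S" using iw by (force simp: S_def)
      qed
      ultimately have "cover_number ?k ?V ?E \<chi> \<le> card S"
        unfolding cover_number_def using fin by (intro Least_le) (auto simp: S_def)
      also have "\<dots> \<le> r" using card_image_le[OF fin] T(2) unfolding S_def by (rule order_trans)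
      finally show False using big by simp
    qed
  qed
  show False by (rule contradiction)
qed

subsection \<open>The lower bound\<close>

lemma finite_mono_components: "finite V \<Longrightarrow> finite (mono_components k V E \<chi>)"
  unfolding mono_components_def components_def
  by (intro finite_UN_I finite_quotient) (auto simp: linked_def)

lemma constant_on_component:
  assumes const: "\<And>e x y. \<lbrakk>e \<in> E; x \<in> e; y \<in> e\<rbrakk> \<Longrightarrow> f x = f y" and xy: "(x, y) \<in> linked V E"
  shows "f x = f y"
proof -
  have "f x = f y" if "edge_sequence E x y es" for es
    using that
  proof (induction es arbitrary: x)
    case Nil
    then show ?case by (simp add: edge_sequence_def)
  next
    case (Cons e es)
    have e: "e \<in> E" "x \<in> e" using Cons.prems by (auto simp: edge_sequence_def)
    show ?case
    proof (cases "es = []")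
      case True
      then show ?thesis using Cons.prems const[of e x y] by (auto simp: edge_sequence_def)
    next
      case False
      have "Suc 0 < length (e # es)" using False by simp
      then have "(e # es) ! 0 \<inter> (e # es) ! Suc 0 \<noteq> {}"
        using Cons.prems unfolding edge_sequence_def by blast
      then obtain z where z: "z \<in> e" "z \<in> hd es" using False by (auto simp: hd_conv_nth)
      have "edge_sequence E z y es"
        unfolding edge_sequence_def
      proof (intro conjI allI impI)
        fix j assume "Suc j < length es"
        then have "(e # es) ! Suc j \<inter> (e # es) ! Suc (Suc j) \<noteq> {}"
          using Cons.prems unfolding edge_sequence_def by (metis Suc_less_eq length_Cons)
        then show "es ! j \<inter> es ! Suc j \<noteq> {}" by simp
      qed (use Cons.prems False z in \<open>auto simp: edge_sequence_def\<close>)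
      then show ?thesis using Cons.IH const[OF e z(1)] by simp
    qed
  qed
  then show ?thesis using xy by (auto simp: linked_def)
qed

text \<open>A component of color \<open>i\<close> lies in a level set of \<open>\<phi> i\<close>, so
  \<open>m\<close> components cover no more than \<open>m\<close> suitable pairs of a color and a
  value.\<close>

lemma cover_number_gt:
  fixes \<phi> :: "nat \<Rightarrow> 'a \<Rightarrow> 'b"
  assumes V: "finite V" and k: "k \<ge> 1"
    and const: "\<And>e x y. \<lbrakk>e \<in> E; x \<in> e; y \<in> e\<rbrakk> \<Longrightarrow> \<phi> (\<chi> e) x = \<phi> (\<chi> e) y"
    and uncovered: "\<And>T. \<lbrakk>T \<subseteq> {1..k} \<times> UNIV; finite T; card T \<le> m\<rbrakk> \<Longrightarrow> \<exists>z\<in>V. \<forall>i. (i, \<phi> i z) \<notin> T"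
  shows "m < cover_number k V E \<chi>"
proof -
  let ?Q = "\<lambda>n. \<exists>S. S \<subseteq> mono_components k V E \<chi> \<and> finite S \<and> card S = n \<and> V \<subseteq> \<Union>S"
  have "V \<subseteq> \<Union>(mono_components k V E \<chi>)"
    using k Union_quotient[OF equiv_linked, of V "{e \<in> E. \<chi> e = 1}"]
    by (fastforce simp: mono_components_def components_def)
  then have "?Q (card (mono_components k V E \<chi>))" using finite_mono_components[OF V] by blast
  then have "?Q (cover_number k V E \<chi>)" unfolding cover_number_def by (rule LeastI)
  then obtain S where S: "S \<subseteq> mono_components k V E \<chi>" "finite S"
    "card S = cover_number k V E \<chi>" "V \<subseteq> \<Union>S" by blast
  have "\<exists>i a. i \<in> {1..k} \<and> (\<forall>z\<in>D. \<phi> i z = a)" if D: "D \<in> S" for D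
  proof -
    obtain i where i: "i \<in> {1..k}" "D \<in> V // linked V {e \<in> E. \<chi> e = i}"
      using D S(1) by (auto simp: mono_components_def components_def)
    then obtain x where x: "D = linked V {e \<in> E. \<chi> e = i} `` {x}" by (auto simp: quotient_def)
    have "\<phi> i x = \<phi> i z" if "z \<in> D" for z
    proof (rule constant_on_component[where f = "\<phi> i"])
      show "(x, z) \<in> linked V {e \<in> E. \<chi> e = i}" using that x by simp
      show "\<phi> i x = \<phi> i y" if "e \<in> {e \<in> E. \<chi> e = i}" "x \<in> e" "y \<in> e" for e x y
        using const[of e x y] that by simp
    qed
    then show ?thesis using i(1) by metis
  qed
  then obtain i a where ia: "\<And>D. D \<in> S \<Longrightarrow> i D \<in> {1..k}" "\<And>D z. \<lbrakk>D \<in> S; z \<in> D\<rbrakk> \<Longrightarrow> \<phi> (i D) z = a D"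
    by metis
  show ?thesis
  proof (rule ccontr)
    assume "\<not> ?thesis"
    then have "card ((\<lambda>D. (i D, a D)) ` S) \<le> m"
      using card_image_le[OF S(2), of "\<lambda>D. (i D, a D)"] S(3) by linarith
    moreover have "(\<lambda>D. (i D, a D)) ` S \<subseteq> {1..k} \<times> UNIV" using ia(1) by blast
    ultimately obtain z where z: "z \<in> V" "\<forall>j. (j, \<phi> j z) \<notin> (\<lambda>D. (i D, a D)) ` S"
      using uncovered[of "(\<lambda>D. (i D, a D)) ` S"] S(2) by blast
    then obtain D where "D \<in> S" "z \<in> D" using S(4) by blast
    then show False using z(2) ia(2) by force
  qed
qed

section \<open>The extremal coloring by sparse vectors\<close>

lemma disjoint_subsets_of_sizes:
  assumes "finite J" "finite X" "sum N J \<le> card X"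
  shows "\<exists>T. (\<forall>j\<in>J. T j \<subseteq> X \<and> card (T j) = N j) \<and> disjoint_family_on T J"
  using assms
proof (induction J arbitrary: X)
  case empty
  then show ?case by (simp add: disjoint_family_on_def)
next
  case (insert m J)
  have "N m \<le> card X" using insert by simp
  then obtain Y where Y: "Y \<subseteq> X" "card Y = N m" "finite Y" by (rule obtain_subset_with_card_n)
  have "sum N J \<le> card (X - Y)" using insert Y by (simp add: card_Diff_subset)
  then obtain T where T: "\<And>j. j \<in> J \<Longrightarrow> T j \<subseteq> X - Y \<and> card (T j) = N j" "disjoint_family_on T J"
    using insert.IH[of "X - Y"] insert.prems by auto
  have "disjoint_family_on (T(m := Y)) (insert m J)"
    using T insert.hyps(2) unfolding disjoint_family_on_def by auto
  moreover have "\<forall>j\<in>insert m J. (T(m := Y)) j \<subseteq> X \<and> card ((T(m := Y)) j) = N j"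
    using T(1) Y by auto
  ultimately show ?case by blast
qed

text \<open>A vertex of class \<open>j\<close> is a vector with coordinates \<open>1..2r - 1\<close>, encoded as a number.
  In an edge, the numbers of nonzero coordinates add up to \<open>(2r - 1) - 1\<close>, so some coordinate
  vanishes on the whole edge.\<close>

definition support_size :: "nat \<Rightarrow> nat \<Rightarrow> nat" where
  "support_size r j = (if j = 1 then r - 1 else 1)"

text \<open>The bound \<open>r\<close> leaves \<open>r\<close> nonzero values per coordinate, more
  than \<open>r - 1\<close> components can forbid, and keeps the classes finite.\<close>

definition sparse_vectors :: "nat \<Rightarrow> nat \<Rightarrow> (nat \<Rightarrow> nat) set" where
  "sparse_vectors r n =
    {f. (\<forall>i. f i \<le> r) \<and> {i. f i \<noteq> 0} \<subseteq> {1..2 * r - 1} \<and> card {i. f i \<noteq> 0} = n}"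

text \<open>Encoding \<open>j\<close> keeps equal vectors of different classes apart. The list
  starts at index \<open>0\<close>, where sparse vectors vanish, so that coordinate \<open>i\<close>
  sits at position \<open>i\<close>.\<close>

definition vertex :: "nat \<Rightarrow> nat \<Rightarrow> (nat \<Rightarrow> nat) \<Rightarrow> nat" where
  "vertex r j f = to_nat (j, map f [0..<2 * r])"

definition coord :: "nat \<Rightarrow> nat \<Rightarrow> nat" where
  "coord i v = snd (from_nat v :: nat \<times> nat list) ! i"

definition sparse_classes :: "nat \<Rightarrow> nat \<Rightarrow> nat set" where
  "sparse_classes r j = vertex r j ` sparse_vectors r (support_size r j)"

text \<open>Nonzero agreement takes precedence: an edge with a common nonzero value in coordinate
  \<open>i\<close> may also have common zeros, and must still be able to receive color
  \<open>i\<close> for the coloring to be spanning.\<close>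

definition coord_coloring :: "nat \<Rightarrow> nat set \<Rightarrow> nat" where
  "coord_coloring r e =
    (if \<exists>i\<in>{1..2 * r - 1}. \<exists>a>0. \<forall>x\<in>e. coord i x = a
     then SOME i. i \<in> {1..2 * r - 1} \<and> (\<exists>a>0. \<forall>x\<in>e. coord i x = a)
     else SOME i. i \<in> {1..2 * r - 1} \<and> (\<forall>x\<in>e. coord i x = 0))"

lemma coord_vertex [simp]: "i \<in> {1..2 * r - 1} \<Longrightarrow> coord i (vertex r j f) = f i"
  by (auto simp: coord_def vertex_def nth_map)

lemma sparse_vectorsI:
  assumes "T \<subseteq> {1..2 * r - 1}" "card T = n" "\<And>i. i \<in> T \<Longrightarrow> 0 < b i \<and> b i \<le> r"
  shows "(\<lambda>i. if i \<in> T then b i else 0) \<in> sparse_vectors r n"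
proof -
  have "{i. (if i \<in> T then b i else 0) \<noteq> 0} = T" using assms(3) by (auto split: if_splits)
  then show ?thesis using assms by (simp add: sparse_vectors_def)
qed

lemma sparse_vector_with_support:
  assumes "i \<in> {1..2 * r - 1}" "1 \<le> n" "n \<le> 2 * r - 1" "0 < a" "a \<le> r"
  obtains f where "f \<in> sparse_vectors r n" "f i = a"
proof -
  obtain T where T: "{i} \<subseteq> T" "T \<subseteq> {1..2 * r - 1}" "card T = n"
    using exists_subset_between[of "{i}" n "{1..2 * r - 1}"] assms by auto
  show ?thesis
    using that[of "\<lambda>m. if m \<in> T then a else 0"] sparse_vectorsI[of T r n "\<lambda>_. a"] T assms by auto
qed

lemma support_size_bounds:
  "r \<ge> 2 \<Longrightarrow> 1 \<le> support_size r j" "r \<ge> 2 \<Longrightarrow> support_size r j \<le> 2 * r - 1"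
  by (auto simp: support_size_def)

lemma sum_support_size:
  assumes "r \<ge> 1" shows "(\<Sum>j\<in>{1..r}. support_size r j) = 2 * r - 2"
proof -
  have "(\<Sum>j\<in>{1..r}. support_size r j) = support_size r 1 + (\<Sum>j\<in>{1..r} - {1}. support_size r j)"
    using assms by (intro sum.remove) auto
  also have "(\<Sum>j\<in>{1..r} - {1}. support_size r j) = (\<Sum>j\<in>{1..r} - {1}. 1)"
    by (intro sum.cong) (auto simp: support_size_def)
  also have "\<dots> = r - 1" using assms by simp
  finally show ?thesis by (simp add: support_size_def)
qed

lemma partite_sparse_classes:
  assumes "r \<ge> 2" shows "partite_classes r (sparse_classes r)"
proof -
  have "finite (sparse_classes r j)" for j
  proof (rule finite_subset)
    show "sparse_classes r j \<subseteq> (\<lambda>xs. to_nat (j, xs)) ` {xs. set xs \<subseteq> {..r} \<and> length xs = 2 * r}"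
      by (auto simp: sparse_classes_def vertex_def sparse_vectors_def intro!: imageI)
    show "finite ((\<lambda>xs. to_nat (j, xs)) ` {xs. set xs \<subseteq> {..r} \<and> length xs = 2 * r})"
      by (intro finite_imageI finite_lists_length_eq) simp
  qed
  moreover have "sparse_classes r j \<noteq> {}" for j
  proof -
    obtain f where "f \<in> sparse_vectors r (support_size r j)"
      using sparse_vector_with_support[of 1 r "support_size r j" 1] support_size_bounds[OF assms, of j] assms
      by auto
    then show ?thesis by (auto simp: sparse_classes_def)
  qed
  moreover have "disjoint_family_on (sparse_classes r) {1..r}"
    by (auto simp: disjoint_family_on_def sparse_classes_def vertex_def)
  ultimately show ?thesis by (simp add: partite_classes_def)
qed

lemma sparse_edge:
  assumes "e \<in> complete_edges r (sparse_classes r)"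
  obtains h where "\<And>j. j \<in> {1..r} \<Longrightarrow> h j \<in> sparse_vectors r (support_size r j)"
    "e = (\<lambda>j. vertex r j (h j)) ` {1..r}"
proof -
  obtain f where f: "\<And>j. j \<in> {1..r} \<Longrightarrow> f j \<in> sparse_classes r j" "e = f ` {1..r}"
    using complete_edges_transversal[OF assms] by metis
  then obtain h where "\<And>j. j \<in> {1..r} \<Longrightarrow> h j \<in> sparse_vectors r (support_size r j) \<and> f j = vertex r j (h j)"
    unfolding sparse_classes_def image_iff by metis
  with f(2) show ?thesis by (intro that[of h]) auto
qed

lemma sparse_edge_common_zero:
  assumes r: "r \<ge> 1" and e: "e \<in> complete_edges r (sparse_classes r)"
  shows "\<exists>i\<in>{1..2 * r - 1}. \<forall>x\<in>e. coord i x = 0"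
proof -
  obtain h where h: "\<And>j. j \<in> {1..r} \<Longrightarrow> h j \<in> sparse_vectors r (support_size r j)"
    "e = (\<lambda>j. vertex r j (h j)) ` {1..r}" using sparse_edge[OF e] by metis
  let ?U = "\<Union>j\<in>{1..r}. {i. h j i \<noteq> 0}"
  have "card ?U \<le> (\<Sum>j\<in>{1..r}. card {i. h j i \<noteq> 0})" by (intro card_UN_le) simp
  also have "\<dots> = (\<Sum>j\<in>{1..r}. support_size r j)"
    using h(1) by (intro sum.cong) (auto simp: sparse_vectors_def)
  finally have "card ?U < card {1..2 * r - 1}" using sum_support_size[OF r] r by simp
  then have "\<not> {1..2 * r - 1} \<subseteq> ?U"
    using card_mono[of ?U "{1..2 * r - 1}"] h(1) finite_subset[of ?U "{1..2 * r - 1}"]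
    by (fastforce simp: sparse_vectors_def)
  then show ?thesis using h(2) by auto
qed

lemma coord_coloring_cases:
  assumes "r \<ge> 1" "e \<in> complete_edges r (sparse_classes r)"
  shows "coord_coloring r e \<in> {1..2 * r - 1} \<and> (\<exists>a. \<forall>x\<in>e. coord (coord_coloring r e) x = a)"
proof (cases "\<exists>i\<in>{1..2 * r - 1}. \<exists>a>0. \<forall>x\<in>e. coord i x = a")
  case True
  then have "\<exists>i. i \<in> {1..2 * r - 1} \<and> (\<exists>a>0. \<forall>x\<in>e. coord i x = a)" by blast
  from someI_ex[OF this] show ?thesis unfolding coord_coloring_def if_P[OF True] by blast
next
  case False
  have "\<exists>i. i \<in> {1..2 * r - 1} \<and> (\<forall>x\<in>e. coord i x = 0)"
    using sparse_edge_common_zero[OF assms] by blast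
  from someI_ex[OF this] show ?thesis unfolding coord_coloring_def if_not_P[OF False] by blast
qed

lemma coord_coloring_nonzero:
  assumes "i \<in> {1..2 * r - 1}" "a > 0" "\<And>x. x \<in> e \<Longrightarrow> coord i x = a"
    and "\<And>i' a'. \<lbrakk>i' \<in> {1..2 * r - 1}; a' > 0; \<And>x. x \<in> e \<Longrightarrow> coord i' x = a'\<rbrakk> \<Longrightarrow> i' = i"
  shows "coord_coloring r e = i"
proof -
  have *: "\<exists>i\<in>{1..2 * r - 1}. \<exists>a>0. \<forall>x\<in>e. coord i x = a" using assms by blast
  show ?thesis unfolding coord_coloring_def if_P[OF *]
    by (rule some_equality) (use assms in blast)+
qed

lemma coord_coloring_zero:
  assumes "i \<in> {1..2 * r - 1}" "\<And>x. x \<in> e \<Longrightarrow> coord i x = 0"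
    and "\<And>i' a. \<lbrakk>i' \<in> {1..2 * r - 1}; \<And>x. x \<in> e \<Longrightarrow> coord i' x = a\<rbrakk> \<Longrightarrow> i' = i"
    and "e \<noteq> {}"
  shows "coord_coloring r e = i"
proof -
  have *: "\<not> (\<exists>i\<in>{1..2 * r - 1}. \<exists>a>0. \<forall>x\<in>e. coord i x = a)"
    using assms by (metis all_not_in_conv less_irrefl)
  show ?thesis unfolding coord_coloring_def if_not_P[OF *]
    by (rule some_equality) (use assms in blast)+
qed

lemma spanning_coord_coloring:
  assumes r: "r \<ge> 3"
  shows "spanning (verts r (sparse_classes r)) (complete_edges r (sparse_classes r)) (coord_coloring r)"
  unfolding spanning_def
proof (intro ballI)
  let ?E = "complete_edges r (sparse_classes r)"
  fix v i assume v: "v \<in> verts r (sparse_classes r)" and "i \<in> coord_coloring r ` ?E"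
  then have i: "i \<in> {1..2 * r - 1}" using coord_coloring_cases[of r] r by auto
  obtain m f where m: "m \<in> {1..r}" and f: "f \<in> sparse_vectors r (support_size r m)" "v = vertex r m f"
    using v by (auto simp: verts_def sparse_classes_def)
  have r2: "r \<ge> 2" "r \<ge> 1" using r by auto
  have edge: "(\<lambda>j. vertex r j (h j)) ` {1..r} \<in> ?E"
    if "\<And>j. j \<in> {1..r} \<Longrightarrow> h j \<in> sparse_vectors r (support_size r j)" for h
    using that by (intro transversal_in_complete_edges partite_sparse_classes[OF r2(1)]) (auto simp: sparse_classes_def)
  show "\<exists>e\<in>?E. v \<in> e \<and> coord_coloring r e = i"
  proof (cases "f i = 0")
    case False
    have "\<exists>g. g \<in> sparse_vectors r (support_size r j) \<and> g i = f i" for j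
    proof -
      have "0 < f i" "f i \<le> r" using False f(1) by (simp_all add: sparse_vectors_def)
      from sparse_vector_with_support[OF i support_size_bounds[OF r2(1)] this] show ?thesis by blast
    qed
    then obtain g where g: "\<And>j. g j \<in> sparse_vectors r (support_size r j)" "\<And>j. g j i = f i" by metis
    define h where "h = g(m := f)"
    have h: "\<And>j. h j \<in> sparse_vectors r (support_size r j)" "\<And>j. h j i = f i"
      using g f by (auto simp: h_def)
    define e where "e = (\<lambda>j. vertex r j (h j)) ` {1..r}"
    have "coord_coloring r e = i"
    proof (rule coord_coloring_nonzero[OF i, of "f i"])
      show "0 < f i" using False by simp
      show "coord i x = f i" if "x \<in> e" for x using that h(2) i by (auto simp: e_def)
      fix i' a assume i': "i' \<in> {1..2 * r - 1}" "0 < a" "\<And>x. x \<in> e \<Longrightarrow> coord i' x = a"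
      \<comment> \<open>The vector of class \<open>2\<close> has a single nonzero coordinate, so
        \<open>i\<close> is the only candidate.\<close>
      have "vertex r 2 (h 2) \<in> e" using r by (auto simp: e_def)
      then have "h 2 i' \<noteq> 0" using i' by fastforce
      moreover have "h 2 i \<noteq> 0" using h False by simp
      moreover have "card {i. h 2 i \<noteq> 0} = 1" using h(1)[of 2] by (simp add: sparse_vectors_def support_size_def)
      then obtain l where "{i. h 2 i \<noteq> 0} = {l}" by (auto simp: card_1_singleton_iff)
      ultimately show "i' = i" by (metis (mono_tags, lifting) mem_Collect_eq singletonD)
    qed
    moreover have "v \<in> e" using m f by (auto simp: e_def h_def)
    moreover have "e \<in> ?E" unfolding e_def using h by (intro edge)
    ultimately show ?thesis by blast
  next
    case True
    \<comment> \<open>\<open>X\<close> has exactly the size needed for the supports of the other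
      classes to partition it. The edge then vanishes jointly at \<open>i\<close> only, and no
      coordinate is nonzero throughout.\<close>
    define X where "X = {1..2 * r - 1} - {i} - {l. f l \<noteq> 0}"
    have sup: "{l. f l \<noteq> 0} \<subseteq> {1..2 * r - 1} - {i}" "card {l. f l \<noteq> 0} = support_size r m"
      using f True by (auto simp: sparse_vectors_def)
    have "card X = 2 * r - 2 - support_size r m"
      using sup i unfolding X_def by (subst card_Diff_subset) (auto intro: finite_subset)
    moreover have "2 * r - 2 = support_size r m + (\<Sum>j\<in>{1..r} - {m}. support_size r j)"
      using sum_support_size[OF r2(2)] sum.remove[OF _ m, of "support_size r"] by simp
    ultimately have cX: "card X = (\<Sum>j\<in>{1..r} - {m}. support_size r j)" by simp
    have fX: "finite X" by (simp add: X_def)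
    obtain T where T: "\<And>j. j \<in> {1..r} - {m} \<Longrightarrow> T j \<subseteq> X \<and> card (T j) = support_size r j"
      "disjoint_family_on T ({1..r} - {m})"
      using disjoint_subsets_of_sizes[OF _ fX, of "{1..r} - {m}" "support_size r"] cX
      by (metis finite_Diff finite_atLeastAtMost order_refl)
    have UT: "(\<Union>j\<in>{1..r} - {m}. T j) = X"
    proof (rule card_seteq[OF fX])
      show "(\<Union>j\<in>{1..r} - {m}. T j) \<subseteq> X" using T(1) by blast
      have "card (\<Union>j\<in>{1..r} - {m}. T j) = (\<Sum>j\<in>{1..r} - {m}. card (T j))"
      proof (rule card_UN_disjoint)
        show "\<forall>j\<in>{1..r} - {m}. finite (T j)" using T(1) finite_subset[OF _ fX] by blast
        show "\<forall>j\<in>{1..r} - {m}. \<forall>l\<in>{1..r} - {m}. j \<noteq> l \<longrightarrow> T j \<inter> T l = {}"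
          using T(2) unfolding disjoint_family_on_def by blast
      qed simp
      also have "\<dots> = card X" unfolding cX using T(1) by (intro sum.cong) auto
      finally show "card X \<le> card (\<Union>j\<in>{1..r} - {m}. T j)" by simp
    qed
    define h where "h j = (if j = m then f else (\<lambda>l. if l \<in> T j then 1 else 0))" for j
    define e where "e = (\<lambda>j. vertex r j (h j)) ` {1..r}"
    have h: "h j \<in> sparse_vectors r (support_size r j)" if "j \<in> {1..r}" for j
      using f(1) T(1)[of j] that r sparse_vectorsI[of "T j" r "support_size r j" "\<lambda>_. 1"]
      by (auto simp: h_def X_def)
    have nonzero: "\<exists>j\<in>{1..r}. h j l \<noteq> 0" if "l \<in> {1..2 * r - 1}" "l \<noteq> i" for l
    proof (cases "f l = 0")
      case True
      then have "l \<in> X" using that by (simp add: X_def)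
      then obtain j where "j \<in> {1..r} - {m}" "l \<in> T j" using UT by blast
      then show ?thesis by (intro bexI[of _ j]) (auto simp: h_def)
    next
      case False
      then show ?thesis using m by (intro bexI[of _ m]) (auto simp: h_def)
    qed
    have zero: "\<exists>j\<in>{1..r}. h j l = 0" if "l \<in> {1..2 * r - 1}" for l
    proof (rule ccontr)
      assume neg: "\<not> ?thesis"
      obtain j where j: "j \<in> {1..r}" "j \<noteq> m"
      proof -
        have "1 \<in> {1..r}" "2 \<in> {1..r}" using r by auto
        then show ?thesis using that[of 1] that[of 2] by force
      qed
      have "h m l \<noteq> 0" "h j l \<noteq> 0" using neg m j by auto
      then show False using T(1)[of j] j by (auto simp: h_def X_def split: if_splits)
    qed
    have "coord_coloring r e = i"
    proof (rule coord_coloring_zero[OF i])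
      have "h j i = 0" if "j \<in> {1..r}" for j
        using T(1)[of j] that True by (auto simp: h_def X_def)
      then show "coord i x = 0" if "x \<in> e" for x
        using that i by (auto simp: e_def)
      show "e \<noteq> {}" using r by (simp add: e_def)
      fix i' a assume i': "i' \<in> {1..2 * r - 1}" "\<And>x. x \<in> e \<Longrightarrow> coord i' x = a"
      have *: "h j i' = a" if "j \<in> {1..r}" for j
        using i'(2)[of "vertex r j (h j)"] that i'(1) by (auto simp: e_def)
      then show "i' = i" using zero[OF i'(1)] nonzero[OF i'(1)] by metis
    qed
    moreover have "v \<in> e" using m f by (auto simp: e_def h_def)
    moreover have "e \<in> ?E" unfolding e_def using h by (intro edge)
    ultimately show ?thesis by blast
  qed
qed

text \<open>The coordinates occurring in \<open>T\<close> fit into a set \<open>Z\<close> of size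
  \<open>r - 1\<close>, and at each of them one of the values \<open>1\<close> to \<open>r\<close>
  is not forbidden. The zeros outside \<open>Z\<close> meet no pair of \<open>T\<close>.\<close>

lemma sparse_vector_avoiding:
  assumes r: "r \<ge> 1" and T: "T \<subseteq> {1..2 * r - 1} \<times> UNIV" "finite T" "card T \<le> r - 1"
  shows "\<exists>f\<in>sparse_vectors r (r - 1). \<forall>i. (i, f i) \<notin> T"
proof -
  have "card (fst ` T) \<le> r - 1" using card_image_le[OF T(2), of fst] T(3) by linarith
  then obtain Z where Z: "fst ` T \<subseteq> Z" "Z \<subseteq> {1..2 * r - 1}" "card Z = r - 1"
    using exists_subset_between[of "fst ` T" "r - 1" "{1..2 * r - 1}"] T(1) r by fastforce
  have "\<exists>a. 0 < a \<and> a \<le> r \<and> (i, a) \<notin> T" for i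
  proof (rule ccontr)
    assume "\<not> ?thesis"
    then have "Pair i ` {1..r} \<subseteq> T" by auto
    then have "card (Pair i ` {1..r}) \<le> card T" using T(2) by (intro card_mono)
    then show False using T(3) r by (simp add: card_image inj_on_def)
  qed
  then obtain b where b: "\<And>i. 0 < b i \<and> b i \<le> r" "\<And>i. (i, b i) \<notin> T" by metis
  have "(\<lambda>i. if i \<in> Z then b i else 0) \<in> sparse_vectors r (r - 1)"
    using Z b by (intro sparse_vectorsI) auto
  then show ?thesis
    using b(2) Z(1) by (intro bexI[of _ "\<lambda>i. if i \<in> Z then b i else 0"]) (auto simp: image_subset_iff)
qed

lemma cover_number_sparse_ge:
  assumes r: "r \<ge> 3"
  shows "r \<le> cover_number (2 * r - 1) (verts r (sparse_classes r))
    (complete_edges r (sparse_classes r)) (coord_coloring r)"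
proof -
  let ?V = "verts r (sparse_classes r)"
  have "r - 1 < cover_number (2 * r - 1) ?V (complete_edges r (sparse_classes r)) (coord_coloring r)"
  proof (rule cover_number_gt[where \<phi> = coord])
    show "finite ?V" using r by (intro finite_verts partite_sparse_classes) simp
    show "1 \<le> 2 * r - 1" using r by simp
    show "coord (coord_coloring r e) x = coord (coord_coloring r e) y"
      if "e \<in> complete_edges r (sparse_classes r)" "x \<in> e" "y \<in> e" for e x y
      using coord_coloring_cases[of r e] that r by auto
    fix T :: "(nat \<times> nat) set" assume T: "T \<subseteq> {1..2 * r - 1} \<times> UNIV" "finite T" "card T \<le> r - 1"
    obtain f where f: "f \<in> sparse_vectors r (r - 1)" "\<And>i. (i, f i) \<notin> T"
      using sparse_vector_avoiding[OF _ T] r by auto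
    have "vertex r 1 f \<in> ?V"
      using f(1) r by (force simp: verts_def sparse_classes_def support_size_def)
    moreover have "(i, coord i (vertex r 1 f)) \<notin> T" for i
      using f(2)[of i] T(1) by (cases "i \<in> {1..2 * r - 1}") auto
    ultimately show "\<exists>z\<in>?V. \<forall>i. (i, coord i z) \<notin> T" by blast
  qed
  then show ?thesis by simp
qed

theorem theorem2p7:
  fixes r :: nat
  assumes "r \<ge> 3"
  shows "cov r (2 * r - 1) = r"
  unfolding cov_def
proof (rule Max_eqI)
  show "finite (cover_numbers r (2 * r - 1))" using assms by (intro cover_numbers_finite) simp
  show "n \<le> r" if "n \<in> cover_numbers r (2 * r - 1)" for n
    using that cover_number_le_r[OF assms] by (auto simp: cover_numbers_def)
  let ?P = "sparse_classes r" and ?\<chi> = "coord_coloring r"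
  have P: "partite_classes r ?P" using assms by (intro partite_sparse_classes) simp
  have \<chi>: "edge_coloring (2 * r - 1) (complete_edges r ?P) ?\<chi>"
    using coord_coloring_cases[of r] assms by (auto simp: edge_coloring_def)
  note span = spanning_coord_coloring[OF assms]
  have "cover_number (2 * r - 1) (verts r ?P) (complete_edges r ?P) ?\<chi> = r"
    using cover_number_sparse_ge[OF assms] cover_number_le_r[OF assms P \<chi> span] by (rule antisym[rotated])
  then show "r \<in> cover_numbers r (2 * r - 1)" unfolding cover_numbers_def using P \<chi> span
    by (intro CollectI exI[of _ ?P] exI[of _ ?\<chi>]) simp
qed

end
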